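(* If $n\geq 4$ is an integer, then $\iota(S_n)\leq \left\lfloor\frac{n+8}{4}\right\rfloor$.
   Context: $S_n$ denotes the symmetric group on $n$ symbols. The Frattini subgroup $\Phi(G)$ of a finite group $G$ is the intersection of all maximal subgroups of $G$. For a nontrivial finite group $G$, the intersection number $\iota(G)$ is the minimum number of maximal subgroups of $G$ whose intersection equals $\Phi(G)$. *)

theory Defs
  imports Complex_Main "HOL-Algebra.Algebra"
begin

definition maximal_subgroup :: "'a set \<Rightarrow> ('a, 'b) monoid_scheme \<Rightarrow> bool" where
  "maximal_subgroup M G \<longleftrightarrow>
     subgroup M G \<and> M \<noteq> carrier G \<and>
     (\<forall>H. subgroup H G \<and> M \<subseteq> H \<longrightarrow> H = M \<or> H = carrier G)"

(* The factor carrier G only matters when there are no maximal subgroups (for finite G: when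
   G is trivial), where the empty intersection has to be read as G and not as UNIV. *)
definition frattini :: "('a, 'b) monoid_scheme \<Rightarrow> 'a set" where
  "frattini G = carrier G \<inter> \<Inter>{M. maximal_subgroup M G}"

(* For finite G the set of candidates k is nonempty (lemma intersection_number_attained), so
   LEAST is a genuine minimum. *)
definition intersection_number :: "('a, 'b) monoid_scheme \<Rightarrow> nat" where
  "intersection_number G =
     (LEAST k. \<exists>\<M>. finite \<M> \<and> card \<M> = k \<and> (\<forall>M\<in>\<M>. maximal_subgroup M G) \<and>
                 carrier G \<inter> \<Inter>\<M> = frattini G)"

lemma intersection_number_attained:
  assumes "finite (carrier G)"
  shows "\<exists>\<M>. finite \<M> \<and> card \<M> = intersection_number G \<and>
           (\<forall>M\<in>\<M>. maximal_subgroup M G) \<and> carrier G \<inter> \<Inter>\<M> = frattini G"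
  unfolding intersection_number_def
proof (rule LeastI_ex)
  have "{M. maximal_subgroup M G} \<subseteq> Pow (carrier G)"
    by (auto simp: maximal_subgroup_def dest: subgroup.subset)
  then have "finite {M. maximal_subgroup M G}"
    using assms by (meson finite_Pow_iff finite_subset)
  then show "\<exists>k \<M>. finite \<M> \<and> card \<M> = k \<and> (\<forall>M\<in>\<M>. maximal_subgroup M G) \<and>
      carrier G \<inter> \<Inter>\<M> = frattini G"
    by (intro exI[of _ "card {M. maximal_subgroup M G}"] exI[of _ "{M. maximal_subgroup M G}"])
       (simp add: frattini_def)
qed

end

theory Submission
  imports Defs
begin

text \<open>
  The setwise stabiliser of a nonempty set with fewer than \<open>n/2\<close> points is maximal in the symmetric
  group: for a subgroup \<open>H\<close> above it, the relation ``the transposition of \<open>i\<close> and \<open>j\<close> lies in \<open>H\<close>''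
  is an \<open>H\<close>-invariant equivalence; if it is universal then \<open>H\<close> contains all transpositions, and
  otherwise its classes are the set and its complement, which \<open>H\<close> cannot swap. The stabilisers of
  a family of such sets intersect trivially as soon as the sets separate the points. Unless
  \<open>n = 6\<close>, about \<open>n/4\<close> sets suffice, since adding four points costs one more set. For \<open>n = 6\<close>
  one uses a point stabiliser and the stabilisers of two partitions into pairs, the two perfect
  matchings of a hexagon.
\<close>

section \<open>Transpositions in a subgroup of the symmetric group\<close>

text \<open>Conjugating a transposition by \<open>p\<close> relabels its two points by
  \<open>p\<close>. This makes the equivalence on points invariant under \<open>H\<close>.\<close>

lemma transpose_conj_mem:
  assumes H: "subgroup H (sym_group n)" and p: "p \<in> H"
    and ab: "Transposition.transpose a b \<in> H"
  shows "Transposition.transpose (p a) (p b) \<in> H"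
proof -
  have pc: "p \<in> carrier (sym_group n)"
    using H p by (rule subgroup.mem_carrier)
  then have bij: "bij p"
    using permutes_bij by (auto simp: sym_group_carrier)
  have inv: "inv' p \<in> H"
    using subgroup.m_inv_closed[OF H p] pc by simp
  have "Transposition.transpose (p a) (p b) = p \<circ> Transposition.transpose a b \<circ> inv' p"
    using bij by (simp add: fun_eq_iff bij_def surj_f_inv_f inv_f_f inj_eq Transposition.transpose_def)
      (metis surj_f_inv_f)
  moreover have "p \<circ> Transposition.transpose a b \<circ> inv' p \<in> H"
    using subgroup.m_closed[OF H] p ab inv by (simp add: sym_group_mult)
  ultimately show ?thesis by simp
qed

text \<open>In the nondegenerate case, conjugating the first transposition by the second fixes
  \<open>a\<close> and moves \<open>b\<close> to \<open>c\<close>.\<close>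

lemma transpose_mem_trans:
  assumes H: "subgroup H (sym_group n)"
    and ab: "Transposition.transpose a b \<in> H" and bc: "Transposition.transpose b c \<in> H"
  shows "Transposition.transpose a c \<in> H"
proof (cases "a = b \<or> a = c")
  case True
  then show ?thesis
    using bc subgroup.one_closed[OF H] by (auto simp only: sym_group_one transpose_same)
next
  case False
  then show ?thesis
    using transpose_conj_mem[OF H bc ab] by (cases "b = c") auto
qed

text \<open>Any two points are linked through the centre \<open>i\<close> of the star, so all
  transpositions lie in \<open>H\<close>, and these generate the group.\<close>

lemma subgroup_eq_carrier_if_transposes:
  assumes H: "subgroup H (sym_group n)"
    and star: "\<And>k. k \<in> {1..n} \<Longrightarrow> Transposition.transpose i k \<in> H"
  shows "H = carrier (sym_group n)"
proof
  show "H \<subseteq> carrier (sym_group n)"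
    using H by (rule subgroup.subset)
  have "p \<in> H" if "p permutes {1..n}" for p
    using that finite_atLeastAtMost
  proof (induction rule: permutes_induct)
    case id
    then show ?case
      using subgroup.one_closed[OF H] by (simp add: sym_group_one id_def)
  next
    case (swap a b p)
    have "Transposition.transpose a b \<in> H"
      using transpose_mem_trans[OF H] star swap.hyps by (metis transpose_commute)
    then show ?case
      using subgroup.m_closed[OF H] swap.IH by (simp add: sym_group_mult comp_def)
  qed
  then show "carrier (sym_group n) \<subseteq> H"
    by (auto simp: sym_group_carrier)
qed

section \<open>Two kinds of maximal subgroups\<close>

definition set_stabiliser :: "nat \<Rightarrow> nat set \<Rightarrow> (nat \<Rightarrow> nat) set" where
  "set_stabiliser n A = {p. p permutes {1..n} \<and> p ` A = A}"

definition perm_centraliser :: "nat \<Rightarrow> (nat \<Rightarrow> nat) \<Rightarrow> (nat \<Rightarrow> nat) set" where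
  "perm_centraliser n f = {p. p permutes {1..n} \<and> p \<circ> f = f \<circ> p}"

lemma subgroup_set_stabiliser: "subgroup (set_stabiliser n A) (sym_group n)"
proof
  fix p assume "p \<in> set_stabiliser n A"
  then have p: "p permutes {1..n}" "p ` A = A"
    by (auto simp: set_stabiliser_def)
  then have "inv' p ` A = A"
    by (metis image_inv_f_f permutes_inj)
  then show "inv\<^bsub>sym_group n\<^esub> p \<in> set_stabiliser n A"
    using p by (simp add: sym_group_carrier set_stabiliser_def permutes_inv)
qed (auto simp: set_stabiliser_def sym_group_carrier sym_group_mult sym_group_one
      permutes_compose permutes_id image_comp[symmetric] simp del: o_apply)

lemma subgroup_perm_centraliser: "subgroup (perm_centraliser n f) (sym_group n)"
proof
  fix p assume "p \<in> perm_centraliser n f"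
  then have p: "p permutes {1..n}" "p \<circ> f = f \<circ> p"
    by (auto simp: perm_centraliser_def)
  then have "inv' p \<circ> f = f \<circ> inv' p"
    by (metis comp_assoc comp_id id_comp permutes_inv_o)
  then show "inv\<^bsub>sym_group n\<^esub> p \<in> perm_centraliser n f"
    using p by (simp add: sym_group_carrier perm_centraliser_def permutes_inv)
next
  fix p q assume "p \<in> perm_centraliser n f" "q \<in> perm_centraliser n f"
  then show "p \<otimes>\<^bsub>sym_group n\<^esub> q \<in> perm_centraliser n f"
    by (simp add: perm_centraliser_def sym_group_mult permutes_compose) (metis comp_assoc)
qed (auto simp: perm_centraliser_def sym_group_carrier sym_group_one permutes_id)

lemma maximal_set_stabiliser:
  assumes A: "A \<subseteq> {1..n}" "A \<noteq> {}" "2 * card A < n"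
  shows "maximal_subgroup (set_stabiliser n A) (sym_group n)"
  unfolding maximal_subgroup_def
proof (intro conjI allI impI)
  show "subgroup (set_stabiliser n A) (sym_group n)"
    by (rule subgroup_set_stabiliser)
  define B where "B = {1..n} - A"
  have fin: "finite A" "finite B"
    using A finite_subset by (auto simp: B_def)
  have cardB: "card B > card A"
    using A fin by (simp add: B_def card_Diff_subset)
  obtain a where a: "a \<in> A" using A by auto
  obtain b where b: "b \<in> B" using cardB by fastforce
  have "Transposition.transpose a b \<notin> set_stabiliser n A"
    using a b imageI[OF a, of "Transposition.transpose a b"] by (auto simp: set_stabiliser_def B_def)
  moreover have "Transposition.transpose a b \<in> carrier (sym_group n)"
    using a b A by (auto simp: sym_group_carrier B_def intro!: permutes_swap_id)
  ultimately show "set_stabiliser n A \<noteq> carrier (sym_group n)"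
    by blast
  fix H assume "subgroup H (sym_group n) \<and> set_stabiliser n A \<subseteq> H"
  then have H: "subgroup H (sym_group n)" and sub: "set_stabiliser n A \<subseteq> H"
    by auto
  have AA: "Transposition.transpose x y \<in> H" if "x \<in> A" "y \<in> A" for x y
  proof -
    have "Transposition.transpose x y permutes {1..n}"
      using that A by (intro permutes_swap_id) auto
    then have "Transposition.transpose x y \<in> set_stabiliser n A"
      using that by (simp add: set_stabiliser_def)
    then show ?thesis using sub by blast
  qed
  have BB: "Transposition.transpose x y \<in> H" if "x \<in> B" "y \<in> B" for x y
  proof -
    have "Transposition.transpose x y permutes {1..n}"
      using that by (intro permutes_swap_id) (auto simp: B_def)
    then have "Transposition.transpose x y \<in> set_stabiliser n A"
      using that by (simp add: set_stabiliser_def B_def)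
    then show ?thesis using sub by blast
  qed
  show "H = set_stabiliser n A \<or> H = carrier (sym_group n)"
  proof (cases "\<exists>x\<in>A. \<exists>y\<in>B. Transposition.transpose x y \<in> H")
    case True
    then obtain x y where xy: "x \<in> A" "y \<in> B" "Transposition.transpose x y \<in> H"
      by blast
    \<comment> \<open>One transposition across links everything: \<open>k\<close> in
      \<open>A\<close> is reached directly, \<open>k\<close> in \<open>B\<close> through
      \<open>y\<close>.\<close>
    have "Transposition.transpose x k \<in> H" if "k \<in> {1..n}" for k
      using that AA[of x k] transpose_mem_trans[OF H xy(3) BB[of y k]] xy
      by (auto simp: B_def)
    then show ?thesis
      using subgroup_eq_carrier_if_transposes[OF H] by blast
  next
    case False
    have "g ` A = A" if g: "g \<in> H" for g
    proof -
      have perm: "g permutes {1..n}"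
        using subgroup.mem_carrier[OF H g] by (simp add: sym_group_carrier)
      then have inj: "inj g" by (rule permutes_inj)
      have img: "g x \<in> A \<or> g x \<in> B" if "x \<in> B" for x
        using that perm permutes_in_image[OF perm] by (auto simp: B_def)
      have "g ` B \<subseteq> B"
      proof (rule ccontr)
        assume "\<not> g ` B \<subseteq> B"
        then obtain x where x: "x \<in> B" "g x \<in> A"
          using img by blast
        \<comment> \<open>All points of \<open>B\<close> are equivalent, so their images are too;
          since \<open>g x\<close> is in \<open>A\<close> and nothing in \<open>A\<close> is
          equivalent to a point of \<open>B\<close>, every image is in \<open>A\<close>. As
          \<open>B\<close> is larger than \<open>A\<close>, this is impossible.\<close>
        have "g ` B \<subseteq> A"
          using transpose_conj_mem[OF H g BB[OF x(1)]] False x img by blast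
        then have "card B \<le> card A"
          using card_inj_on_le[of g B A] inj fin by (auto intro: inj_on_subset)
        then show False using cardB by simp
      qed
      then have gB: "g ` B = B"
        using fin inj by (meson endo_inj_surj inj_on_subset subset_UNIV)
      have "A = {1..n} - B"
        using A by (auto simp: B_def)
      then show ?thesis
        using gB permutes_image[OF perm] inj by (metis image_set_diff)
    qed
    then have "H \<subseteq> set_stabiliser n A"
      using subgroup.subset[OF H] by (auto simp: set_stabiliser_def sym_group_carrier)
    then show ?thesis using sub by blast
  qed
qed

text \<open>The centraliser of a fixed-point-free involution is the stabiliser of a partition into pairs.\<close>

lemma maximal_perm_centraliser:
  assumes f: "f permutes {1..n}" and inv: "\<And>x. f (f x) = x"
    and fpf: "\<And>x. x \<in> {1..n} \<Longrightarrow> f x \<noteq> x" and n: "n \<ge> 3"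
  shows "maximal_subgroup (perm_centraliser n f) (sym_group n)"
  unfolding maximal_subgroup_def
proof (intro conjI allI impI)
  have f_in: "f x \<in> {1..n} \<longleftrightarrow> x \<in> {1..n}" for x
    using f by (rule permutes_in_image)
  show "subgroup (perm_centraliser n f) (sym_group n)"
    by (rule subgroup_perm_centraliser)
  \<comment> \<open>The bound \<open>n \<ge> 3\<close> provides a point \<open>j\<close> outside the
    pair of 1; swapping 1 and \<open>j\<close> breaks that pair.\<close>
  have "card {1, f 1} < card {1..n}"
    using n by (auto simp: card_insert_if)
  then have "\<not> {1..n} \<subseteq> {1, f 1}"
    using card_mono[of "{1, f 1}" "{1..n}"] by auto
  then obtain j where j: "j \<in> {1..n}" "j \<noteq> 1" "j \<noteq> f 1"
    by blast
  have "Transposition.transpose 1 j \<notin> perm_centraliser n f"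
  proof
    assume "Transposition.transpose 1 j \<in> perm_centraliser n f"
    then have "Transposition.transpose 1 j (f 1) = f (Transposition.transpose 1 j 1)"
      by (metis (mono_tags, lifting) comp_apply mem_Collect_eq perm_centraliser_def)
    then have "f 1 = f j"
      using fpf[of 1] n j by simp
    then show False using inv j by metis
  qed
  moreover have "Transposition.transpose 1 j \<in> carrier (sym_group n)"
    using j n by (auto simp: sym_group_carrier intro!: permutes_swap_id)
  ultimately show "perm_centraliser n f \<noteq> carrier (sym_group n)"
    by blast
  fix H assume "subgroup H (sym_group n) \<and> perm_centraliser n f \<subseteq> H"
  then have H: "subgroup H (sym_group n)" and sub: "perm_centraliser n f \<subseteq> H"
    by auto
  have pair: "Transposition.transpose x (f x) \<in> H" if "x \<in> {1..n}" for x
  proof -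
    have "Transposition.transpose x (f x) permutes {1..n}"
      using that f_in by (intro permutes_swap_id) auto
    moreover have "Transposition.transpose x (f x) \<circ> f = f \<circ> Transposition.transpose x (f x)"
      using inv by (auto simp: fun_eq_iff Transposition.transpose_def) metis+
    ultimately show ?thesis using sub by (auto simp: perm_centraliser_def)
  qed
  \<comment> \<open>The two points of a pair are always equivalent, so the question is whether
    \<open>H\<close> links points of different pairs.\<close>
  show "H = perm_centraliser n f \<or> H = carrier (sym_group n)"
  proof (cases "\<exists>x\<in>{1..n}. \<exists>y\<in>{1..n}. y \<noteq> x \<and> y \<noteq> f x \<and> Transposition.transpose x y \<in> H")
    case True
    then obtain x y where x: "x \<in> {1..n}" and y: "y \<in> {1..n}" "y \<noteq> x" "y \<noteq> f x"
      and xy: "Transposition.transpose x y \<in> H"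
      by blast
    have "Transposition.transpose x k \<in> H" if k: "k \<in> {1..n}" for k
    proof -
      consider "k = x" | "k = f x" | "k = y" | "k = f y" | "k \<notin> {x, f x, y, f y}"
        by blast
      then show ?thesis
      proof cases
        case 1
        then show ?thesis
          using subgroup.one_closed[OF H] by (simp add: sym_group_one)
      next
        case 2
        then show ?thesis using pair x by simp
      next
        case 3
        then show ?thesis using xy by simp
      next
        case 4
        then show ?thesis
          using transpose_mem_trans[OF H xy pair[OF y(1)]] by simp
      next
        case 5
        \<comment> \<open>\<open>q\<close> exchanges the pair of \<open>y\<close> with the pair of
          \<open>k\<close>. It commutes with \<open>f\<close>, fixes \<open>x\<close> and sends
          \<open>y\<close> to \<open>k\<close>, so it conjugates the known transposition into the
          wanted one.\<close>
        define q where "q = Transposition.transpose y k \<circ> Transposition.transpose (f y) (f k)"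
        have "y \<noteq> k" "y \<noteq> f y" "y \<noteq> f k" "k \<noteq> f y" "k \<noteq> f k" "f y \<noteq> f k"
          using 5 fpf[OF y(1)] fpf[OF k] inv[of y] inv[of k] by auto
        then have qv: "q y = k" "q k = y" "q (f y) = f k" "q (f k) = f y"
          by (auto simp: q_def Transposition.transpose_def)
        have qo: "q u = u" if "u \<notin> {y, k, f y, f k}" for u
          using that by (simp add: q_def)
        have "q permutes {1..n}"
          unfolding q_def using k y f_in by (intro permutes_compose permutes_swap_id) auto
        moreover have "q \<circ> f = f \<circ> q"
        proof
          fix z
          show "(q \<circ> f) z = (f \<circ> q) z"
          proof (cases "z \<in> {y, k, f y, f k}")
            case True
            then show ?thesis using qv inv by auto
          next
            case False
            then have "f z \<notin> {y, k, f y, f k}"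
              using inv by (metis insert_iff singletonD)
            then show ?thesis using False qo by simp
          qed
        qed
        ultimately have "q \<in> H" using sub by (auto simp: perm_centraliser_def)
        then have "Transposition.transpose (q x) (q y) \<in> H"
          using xy by (rule transpose_conj_mem[OF H])
        moreover have "x \<notin> {y, k, f y, f k}"
          using 5 y inv[of y] inv[of k] by auto
        then have "q x = x" by (rule qo)
        ultimately show ?thesis using qv(1) by simp
      qed
    qed
    then show ?thesis
      using subgroup_eq_carrier_if_transposes[OF H] by blast
  next
    case False
    have "g \<in> perm_centraliser n f" if g: "g \<in> H" for g
    proof -
      have perm: "g permutes {1..n}"
        using subgroup.mem_carrier[OF H g] by (simp add: sym_group_carrier)
      have "g (f x) = f (g x)" for x
      proof (cases "x \<in> {1..n}")
        case True
        \<comment> \<open>The transposition of \<open>g x\<close> and \<open>g (f x)\<close> lies in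
          \<open>H\<close>, and \<open>H\<close> links distinct points only within a pair; so
          \<open>g\<close> maps pairs to pairs.\<close>
        have "g (f x) \<noteq> g x"
          using fpf[OF True] permutes_inj[OF perm] by (simp add: inj_eq)
        moreover have "g x \<in> {1..n}" "g (f x) \<in> {1..n}"
          using True f_in permutes_in_image[OF perm] by auto
        ultimately show ?thesis
          using False transpose_conj_mem[OF H g pair[OF True]] by blast
      next
        case False
        then show ?thesis
          using f_in[of x] permutes_not_in[OF perm] permutes_not_in[OF f] by simp
      qed
      then show ?thesis using perm by (auto simp: perm_centraliser_def)
    qed
    then show ?thesis using sub by blast
  qed
qed

section \<open>Upper bounds for the intersection number\<close>

text \<open>The Frattini subgroup contains the identity and lies in every such intersection; if the
  intersection is trivial, the two coincide.\<close>

lemma intersection_number_le_card: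
  assumes G: "group G" and fin: "finite \<M>"
    and max: "\<And>M. M \<in> \<M> \<Longrightarrow> maximal_subgroup M G"
    and triv: "carrier G \<inter> \<Inter>\<M> \<subseteq> {\<one>\<^bsub>G\<^esub>}"
  shows "intersection_number G \<le> card \<M>"
proof -
  have "\<one>\<^bsub>G\<^esub> \<in> frattini G"
    using group.is_monoid[OF G]
    by (auto simp: frattini_def maximal_subgroup_def subgroup.one_closed monoid.one_closed)
  moreover have "frattini G \<subseteq> carrier G \<inter> \<Inter>\<M>"
    using max by (auto simp: frattini_def)
  ultimately have "carrier G \<inter> \<Inter>\<M> = frattini G"
    using triv by blast
  then show ?thesis
    unfolding intersection_number_def using fin max by (intro Least_le) blast
qed

section \<open>Separating families of small sets\<close>

text \<open>The first clause collects the hypotheses of \<open>maximal_set_stabiliser\<close>.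
  Indexing by numbers below \<open>m\<close> lets the recursion add a set at index
  \<open>m\<close>.\<close>

definition separating_family :: "nat \<Rightarrow> nat \<Rightarrow> (nat \<Rightarrow> nat set) \<Rightarrow> bool" where
  "separating_family n m A \<longleftrightarrow>
     (\<forall>t<m. A t \<subseteq> {1..n} \<and> A t \<noteq> {} \<and> 2 * card (A t) < n) \<and>
     (\<forall>x\<in>{1..n}. \<forall>y\<in>{1..n}. (\<forall>t<m. x \<in> A t \<longleftrightarrow> y \<in> A t) \<longrightarrow> x = y)"

text \<open>A permutation stabilising every set leaves the membership pattern of each point
  unchanged, and distinct points have distinct patterns.\<close>

lemma intersection_number_le_separating_family:
  assumes "separating_family n m A"
  shows "intersection_number (sym_group n) \<le> m"
proof -
  define \<M> where "\<M> = (\<lambda>t. set_stabiliser n (A t)) ` {..<m}"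
  have "intersection_number (sym_group n) \<le> card \<M>"
  proof (rule intersection_number_le_card[OF sym_group_is_group])
    show "maximal_subgroup M (sym_group n)" if "M \<in> \<M>" for M
      using that assms maximal_set_stabiliser by (auto simp: \<M>_def separating_family_def)
    show "carrier (sym_group n) \<inter> \<Inter>\<M> \<subseteq> {\<one>\<^bsub>sym_group n\<^esub>}"
    proof
      fix p assume p: "p \<in> carrier (sym_group n) \<inter> \<Inter>\<M>"
      then have perm: "p permutes {1..n}" by (simp add: sym_group_carrier)
      have mem: "p x \<in> A t \<longleftrightarrow> x \<in> A t" if "t < m" for t x
      proof -
        have "p ` A t = A t"
          using p that by (auto simp: \<M>_def set_stabiliser_def)
        then show ?thesis
          using permutes_inj[OF perm] by (metis inj_image_mem_iff)
      qed
      have "p x = x" for x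
      proof (cases "x \<in> {1..n}")
        case True
        then show ?thesis
          using assms mem permutes_in_image[OF perm] unfolding separating_family_def by blast
      next
        case False
        then show ?thesis using perm by (rule permutes_not_in[rotated])
      qed
      then show "p \<in> {\<one>\<^bsub>sym_group n\<^esub>}" by (auto simp: sym_group_one)
    qed
  qed (simp add: \<M>_def)
  also have "card \<M> \<le> m"
    unfolding \<M>_def using card_image_le[of "{..<m}"] by fastforce
  finally show ?thesis .
qed

text \<open>The four new points form one new set; three of them are told apart by enlarging three old
  sets by one point each, which keeps every set smaller than half of the points.\<close>

lemma separating_family_step:
  assumes A: "separating_family n m A" and n: "n > 4" and m: "m \<ge> 3"
  shows "\<exists>B. separating_family (n + 4) (Suc m) B"
proof
  \<comment> \<open>Old sets 0, 1, 2 receive \<open>n+2\<close>, \<open>n+3\<close>,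
    \<open>n+4\<close>, hence \<open>m \<ge> 3\<close>; \<open>n+1\<close> lies in the new set only.
    The new set is small enough because \<open>n > 4\<close> gives 8 < \<open>n + 4\<close>.\<close>
  define B where "B t = (if t = m then {n+1..n+4} else if t < 3 then insert (n+2+t) (A t) else A t)" for t
  have card: "card (insert x (A t)) \<le> Suc (card (A t))" for x t
    by (metis card.infinite card_insert_if finite_insert le_SucI order_refl)
  have "B t \<subseteq> {1..n+4} \<and> B t \<noteq> {} \<and> 2 * card (B t) < n + 4" if t: "t < Suc m" for t
  proof (cases "t = m")
    case True
    then show ?thesis using n by (simp add: B_def)
  next
    case False
    then have "A t \<subseteq> {1..n}" "A t \<noteq> {}" "2 * card (A t) < n"
      using t A by (auto simp: separating_family_def)
    then show ?thesis
      using False card[of "n+2+t" t] by (cases "t < 3") (auto simp: B_def)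
  qed
  moreover have "x = y" if x: "x \<in> {1..n+4}" and y: "y \<in> {1..n+4}"
    and eq: "\<And>t. t < Suc m \<Longrightarrow> x \<in> B t \<longleftrightarrow> y \<in> B t" for x y
  proof -
    have sub: "A t \<subseteq> {1..n}" if "t < m" for t
      using that A by (auto simp: separating_family_def)
    have "x \<in> {n+1..n+4} \<longleftrightarrow> y \<in> {n+1..n+4}"
      using eq[of m] by (simp add: B_def)
    then consider "x \<in> {1..n}" "y \<in> {1..n}" | "x > n" "y > n"
      using x y by fastforce
    then show ?thesis
    proof cases
      case 1
      have "x \<in> A t \<longleftrightarrow> y \<in> A t" if "t < m" for t
        using eq[of t] that 1 by (auto simp: B_def split: if_splits)
      then show ?thesis using A 1 unfolding separating_family_def by blast
    next
      case 2
      have "x = n+2+t \<longleftrightarrow> y = n+2+t" if "t < 3" for t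
        using eq[of t] that m 2 sub[of t] by (auto simp: B_def)
      from this[of 0] this[of 1] this[of 2] show ?thesis
        using 2 x y by auto
    qed
  qed
  ultimately show "separating_family (n + 4) (Suc m) B"
    unfolding separating_family_def by blast
qed

text \<open>For \<open>n = 6\<close> no three sets of size less than 3 separate the points.\<close>

lemma separating_family_exists:
  assumes "n \<ge> 4" "n \<noteq> 6"
  shows "\<exists>A. separating_family n (n div 4 + 2) A"
  using assms
proof (induction n rule: less_induct)
  case (less n)
  show ?case
  \<comment> \<open>The step from \<open>n - 4\<close> needs \<open>n - 4 > 4\<close> and
    \<open>n - 4 \<noteq> 6\<close>; these are the values where it fails.\<close>
  proof (cases "n \<in> {4, 5, 7, 8, 10}")
    case True
    \<comment> \<open>In each family with \<open>m\<close> sets, the points 1 to \<open>m\<close>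
      lie in one set each, the last point in none, and the remaining points in distinct pairs of
      sets.\<close>
    have "separating_family 4 3 (\<lambda>t. [{1}, {2}, {3}] ! t)"
      by (simp add: separating_family_def All_less_Suc numeral_eq_Suc atLeastAtMostSuc_conv)
    moreover have "separating_family 5 3 (\<lambda>t. [{1,4}, {2,4}, {3}] ! t)"
      by (simp add: separating_family_def All_less_Suc numeral_eq_Suc atLeastAtMostSuc_conv)
    moreover have "separating_family 7 3 (\<lambda>t. [{1,4,5}, {2,4,6}, {3,5,6}] ! t)"
      by (simp add: separating_family_def All_less_Suc numeral_eq_Suc atLeastAtMostSuc_conv)
    moreover have "separating_family 8 4 (\<lambda>t. [{1,5}, {2,5,6}, {3,6,7}, {4,7}] ! t)"
      by (simp add: separating_family_def All_less_Suc numeral_eq_Suc atLeastAtMostSuc_conv)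
    moreover have "separating_family 10 4 (\<lambda>t. [{1,5,8,9}, {2,5,6}, {3,6,7,9}, {4,7,8}] ! t)"
      by (simp add: separating_family_def All_less_Suc numeral_eq_Suc atLeastAtMostSuc_conv)
    moreover have "n div 4 + 2 = (if n < 8 then 3 else 4)"
      using True by auto
    ultimately show ?thesis using True by (auto simp del: add_2_eq_Suc add_2_eq_Suc')
  next
    case False
    then have n: "n = n - 4 + 4" "n - 4 > 4" "n - 4 \<noteq> 6"
      using less.prems by auto
    then obtain A where "separating_family (n - 4) ((n - 4) div 4 + 2) A"
      using less.IH[of "n - 4"] by auto
    then have "\<exists>B. separating_family (n - 4 + 4) (Suc ((n - 4) div 4 + 2)) B"
      using n by (intro separating_family_step) auto
    moreover have "Suc ((n - 4) div 4 + 2) = n div 4 + 2"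
      using n by presburger
    ultimately show ?thesis using n by simp
  qed
qed

section \<open>The case of six points and the final bound\<close>

text \<open>If a permutation commutes with an involution and fixes a point, it fixes the partner of
  that point. Applying \<open>f\<close> and \<open>g\<close> alternately carries the fixed point 1
  round the hexagon.\<close>

lemma intersection_number_sym_group_6: "intersection_number (sym_group 6) \<le> 3"
proof -
  define f :: "nat \<Rightarrow> nat" where
    "f = Transposition.transpose 1 2 \<circ> Transposition.transpose 3 4 \<circ> Transposition.transpose 5 6"
  define g :: "nat \<Rightarrow> nat" where
    "g = Transposition.transpose 2 3 \<circ> Transposition.transpose 4 5 \<circ> Transposition.transpose 6 1"
  define \<M> where "\<M> = {perm_centraliser 6 f, perm_centraliser 6 g, set_stabiliser 6 {1}}"
  have six: "{1..6} = {1, 2, 3, 4, 5, 6::nat}"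
    by auto
  have ff: "f (f x) = x" and gg: "g (g x) = x" for x
    by (auto simp: f_def g_def Transposition.transpose_def)
  have f: "f permutes {1..6}" and g: "g permutes {1..6}"
    unfolding f_def g_def by (intro permutes_compose permutes_swap_id; simp)+
  have "intersection_number (sym_group 6) \<le> card \<M>"
  proof (rule intersection_number_le_card[OF sym_group_is_group])
    have "maximal_subgroup (perm_centraliser 6 f) (sym_group 6)"
      using f ff by (rule maximal_perm_centraliser) (auto simp: f_def six Transposition.transpose_def)
    moreover have "maximal_subgroup (perm_centraliser 6 g) (sym_group 6)"
      using g gg by (rule maximal_perm_centraliser) (auto simp: g_def six Transposition.transpose_def)
    moreover have "maximal_subgroup (set_stabiliser 6 {1}) (sym_group 6)"
      by (rule maximal_set_stabiliser) auto
    ultimately show "maximal_subgroup M (sym_group 6)" if "M \<in> \<M>" for M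
      using that by (auto simp: \<M>_def)
    show "carrier (sym_group 6) \<inter> \<Inter>\<M> \<subseteq> {\<one>\<^bsub>sym_group 6\<^esub>}"
    proof
      fix p assume "p \<in> carrier (sym_group 6) \<inter> \<Inter>\<M>"
      then have perm: "p permutes {1..6}" and p1: "p 1 = 1"
        and pf: "p \<circ> f = f \<circ> p" and pg: "p \<circ> g = g \<circ> p"
        by (auto simp: \<M>_def sym_group_carrier perm_centraliser_def set_stabiliser_def)
      \<comment> \<open>\<open>f\<close> and \<open>g\<close> are the two perfect matchings of the hexagon 1, ..., 6.\<close>
      have pf': "p x = x \<Longrightarrow> p (f x) = f x" and pg': "p x = x \<Longrightarrow> p (g x) = g x" for x
        using fun_cong[OF pf, of x] fun_cong[OF pg, of x] by auto
      have p2: "p 2 = 2" using pf'[OF p1] by (simp add: f_def Transposition.transpose_def)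
      have p3: "p 3 = 3" using pg'[OF p2] by (simp add: g_def Transposition.transpose_def)
      have p4: "p 4 = 4" using pf'[OF p3] by (simp add: f_def Transposition.transpose_def)
      have p5: "p 5 = 5" using pg'[OF p4] by (simp add: g_def Transposition.transpose_def)
      have p6: "p 6 = 6" using pf'[OF p5] by (simp add: f_def Transposition.transpose_def)
      have "p x = x" for x
        using p1 p2 p3 p4 p5 p6 permutes_not_in[OF perm, of x] unfolding six by blast
      then show "p \<in> {\<one>\<^bsub>sym_group 6\<^esub>}" by (auto simp: sym_group_one)
    qed
  qed (simp add: \<M>_def)
  also have "card \<M> \<le> 3"
    by (simp add: \<M>_def card_insert_if)
  finally show ?thesis .
qed

theorem proposition4p3:
  fixes n :: nat
  assumes "n \<ge> 4"
  shows "int (intersection_number (sym_group n)) \<le> \<lfloor>(real n + 8) / 4\<rfloor>"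
proof -
  have "intersection_number (sym_group n) \<le> n div 4 + 2"
  proof (cases "n = 6")
    case True
    then show ?thesis using intersection_number_sym_group_6 by simp
  next
    case False
    then show ?thesis
      using separating_family_exists assms intersection_number_le_separating_family by blast
  qed
  moreover have "\<lfloor>(real n + 8) / 4\<rfloor> = int (n div 4 + 2)"
    using floor_divide_of_nat_eq[of "n + 8" 4, where 'a = real] by simp
  ultimately show ?thesis by linarith
qed

end
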